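(* Let $p>2$ and $v\in\mathbb{R}$. For every pair $(B,c)$ with either $B>0$ and $c\in\mathbb{R}$, or $B=0$ and $c>0$, let $\theta_{B,c}:(-x_{B,c},x_{B,c})\to\mathbb{R}$ be the function determined by $$\theta_{B,c}(0)=0,\qquad \theta_{B,c}'=-\frac{1}{2\Phi_{B,c}^2}\quad\text{on }(-x_{B,c},x_{B,c}),$$ and define $$Q_{B,c}^v(x)=\begin{cases}\Phi_{B,c}(x)\,e^{iv\theta_{B,c}(x)}&\text{if }x\in(-x_{B,c},x_{B,c}),\\ 0&\text{if }x\notin(-x_{B,c},x_{B,c}).\end{cases}$$ Then $Q=Q_{B,c}^v$ satisfies $$-cQ+ivQ'+\overline{Q}(QQ')'+|Q|^{p-2}Q=0$$ in the sense of distributions on $\mathbb{R}$.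
   Context: The equation is the profile equation for traveling waves $u(t,x)=Q(x-vt)e^{-ict}$ of the degenerate NLS equation $-i\partial_tu+\bar u\,\partial_x(u\partial_xu)+|u|^{p-2}u=0$, with $u$ complex-valued. For $B>0$, $c\in\mathbb{R}$, or $B=0$, $c>0$, the compacton $\Phi_{B,c}$ is the (unique) continuous, nonnegative, even function on $\mathbb{R}$ for which there is $x_{B,c}>0$ such that $\Phi_{B,c}=0$ outside $(-x_{B,c},x_{B,c})$, $\Phi_{B,c}$ is positive and smooth on $(-x_{B,c},x_{B,c})$, decreasing on $(0,x_{B,c})$, and $\phi=\Phi_{B,c}$ satisfies on $(-x_{B,c},x_{B,c})$ both $-c\phi+\phi(\phi\phi')'+\phi^{p-1}=0$ and $-\frac c2\phi^2+\frac12(\phi\phi')^2+\frac1p\phi^p=B$. Convention for the distributional sense: $Q=Q^v_{B,c}$ is continuous on $\mathbb{R}$ and smooth on $(-x_{B,c},x_{B,c})$; $Q'$ is the distributional derivative, and $\overline{Q}(QQ')'$ is the distribution $\psi\mapsto\lim_{\varepsilon\to0^+}\int_{|x|<x_{B,c}-\varepsilon}\overline{Q}(QQ')'\,\psi\,dx$, $\psi\in C_c^\infty(\mathbb{R})$ (no contribution is concentrated at the endpoints, where $Q$ vanishes). *)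

theory Defs
  imports "HOL-Analysis.Analysis"
begin

definition nth_deriv :: "nat \<Rightarrow> (real \<Rightarrow> 'a::real_normed_vector) \<Rightarrow> real \<Rightarrow> 'a" where
  "nth_deriv n f = ((\<lambda>g x. vector_derivative g (at x)) ^^ n) f"

(* Meant for open S only: all derivatives are two-sided. *)
definition smooth_on :: "real set \<Rightarrow> (real \<Rightarrow> 'a::real_normed_vector) \<Rightarrow> bool" where
  "smooth_on S f \<longleftrightarrow> (\<forall>n. \<forall>x\<in>S. nth_deriv n f differentiable (at x))"

definition test_function :: "(real \<Rightarrow> complex) \<Rightarrow> bool" where
  "test_function \<psi> \<longleftrightarrow> smooth_on UNIV \<psi> \<and> compact (closure {x. \<psi> x \<noteq> 0})"

(* Distributions on the real line. Functionals are total functions; only their values on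
   test functions matter. Continuity is the usual seminorm estimate on each compact set. *)
definition distribution :: "((real \<Rightarrow> complex) \<Rightarrow> complex) \<Rightarrow> bool" where
  "distribution T \<longleftrightarrow>
     (\<forall>\<psi> \<eta>. test_function \<psi> \<longrightarrow> test_function \<eta> \<longrightarrow> T (\<lambda>x. \<psi> x + \<eta> x) = T \<psi> + T \<eta>) \<and>
     (\<forall>a \<psi>. test_function \<psi> \<longrightarrow> T (\<lambda>x. a * \<psi> x) = a * T \<psi>) \<and>
     (\<forall>K. compact K \<longrightarrow> (\<exists>C m. \<forall>\<psi>. test_function \<psi> \<longrightarrow> closure {x. \<psi> x \<noteq> 0} \<subseteq> K \<longrightarrow>
        cmod (T \<psi>) \<le> C * (\<Sum>k\<le>m. SUP x. cmod (nth_deriv k \<psi> x))))"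

definition dist_of_fun :: "(real \<Rightarrow> complex) \<Rightarrow> (real \<Rightarrow> complex) \<Rightarrow> complex" where
  "dist_of_fun f \<psi> = (LINT x|lborel. f x * \<psi> x)"

definition dist_deriv :: "((real \<Rightarrow> complex) \<Rightarrow> complex) \<Rightarrow> (real \<Rightarrow> complex) \<Rightarrow> complex" where
  "dist_deriv T \<psi> = - T (\<lambda>x. vector_derivative \<psi> (at x))"

(* X is the half-width of the support. *)
definition compacton :: "real \<Rightarrow> real \<Rightarrow> real \<Rightarrow> real \<Rightarrow> (real \<Rightarrow> real) \<Rightarrow> bool" where
  "compacton p B c X \<Phi> \<longleftrightarrow>
     X > 0 \<and>
     continuous_on UNIV \<Phi> \<and> (\<forall>x. \<Phi> x \<ge> 0) \<and> (\<forall>x. \<Phi> (- x) = \<Phi> x) \<and>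
     (\<forall>x. x \<notin> {-X<..<X} \<longrightarrow> \<Phi> x = 0) \<and>
     (\<forall>x\<in>{-X<..<X}. \<Phi> x > 0) \<and> smooth_on {-X<..<X} \<Phi> \<and>
     strict_antimono_on {0<..<X} \<Phi> \<and>
     (\<forall>x\<in>{-X<..<X}.
        - c * \<Phi> x + \<Phi> x * deriv (\<lambda>y. \<Phi> y * deriv \<Phi> y) x + \<Phi> x powr (p - 1) = 0) \<and>
     (\<forall>x\<in>{-X<..<X}.
        - (c / 2) * (\<Phi> x)\<^sup>2 + 1 / 2 * (\<Phi> x * deriv \<Phi> x)\<^sup>2 + 1 / p * \<Phi> x powr p = B)"

definition phase :: "real \<Rightarrow> (real \<Rightarrow> real) \<Rightarrow> (real \<Rightarrow> real) \<Rightarrow> bool" where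
  "phase X \<Phi> \<theta> \<longleftrightarrow>
     \<theta> 0 = 0 \<and>
     (\<forall>x\<in>{-X<..<X}. (\<theta> has_real_derivative (- 1 / (2 * (\<Phi> x)\<^sup>2))) (at x))"

definition wave_profile ::
  "real \<Rightarrow> real \<Rightarrow> (real \<Rightarrow> real) \<Rightarrow> (real \<Rightarrow> real) \<Rightarrow> real \<Rightarrow> complex" where
  "wave_profile v X \<Phi> \<theta> x =
     (if x \<in> {-X<..<X} then complex_of_real (\<Phi> x) * exp (\<i> * complex_of_real (v * \<theta> x)) else 0)"

(* N is the distribution cnj Q (Q Q')': the limit, as eps decreases to 0, of the pairings over
   |x| < X - eps, so that nothing is concentrated at the endpoints. *)
definition degenerate_term ::
  "real \<Rightarrow> (real \<Rightarrow> complex) \<Rightarrow> ((real \<Rightarrow> complex) \<Rightarrow> complex) \<Rightarrow> bool" where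
  "degenerate_term X Q N \<longleftrightarrow>
     distribution N \<and>
     (\<forall>\<psi>. test_function \<psi> \<longrightarrow>
        ((\<lambda>\<epsilon>. LINT x:{x. \<bar>x\<bar> < X - \<epsilon>}|lborel.
            cnj (Q x) * vector_derivative (\<lambda>y. Q y * vector_derivative Q (at y)) (at x) * \<psi> x)
          \<longlongrightarrow> N \<psi>) (at_right 0))"

definition solves_profile_equation ::
  "real \<Rightarrow> real \<Rightarrow> real \<Rightarrow> real \<Rightarrow> (real \<Rightarrow> complex) \<Rightarrow> bool" where
  "solves_profile_equation p v c X Q \<longleftrightarrow>
     (\<exists>N. degenerate_term X Q N \<and>
       (\<forall>\<psi>. test_function \<psi> \<longrightarrow>
          - complex_of_real c * dist_of_fun Q \<psi>
          + \<i> * complex_of_real v * dist_deriv (dist_of_fun Q) \<psi>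
          + N \<psi>
          + dist_of_fun (\<lambda>x. complex_of_real (cmod (Q x) powr (p - 2)) * Q x) \<psi> = 0))"

end

theory Submission
  imports Defs
begin

text \<open>Inside the support, with \<open>E = exp (i v \<theta>)\<close>, one has
  \<open>Q Q' = (\<Phi> \<Phi>' - i v / 2) E\<^sup>2\<close>, and the choice \<open>\<theta>' = - 1 / (2 \<Phi>\<^sup>2)\<close> makes the singular
  terms of \<open>cnj Q (Q Q')'\<close> and \<open>i v Q'\<close> cancel, so the equation for \<open>Q\<close> reduces to the one for
  \<open>\<Phi>\<close>. Hence \<open>cnj Q (Q Q')' = c Q - |Q|\<^sup>p\<^sup>-\<^sup>2 Q - i v Q'\<close> pointwise; integrating by parts over
  \<open>|x| < X - \<epsilon>\<close>, the boundary terms vanish as \<open>\<epsilon> \<rightarrow> 0\<close> because \<open>Q\<close> is continuous and zero at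
  the endpoints.\<close>

subsection \<open>Test functions and distributions\<close>

lemma nth_deriv_0 [simp]: "nth_deriv 0 f = f"
  by (simp add: nth_deriv_def)

text \<open>\<open>nth_deriv\<close> adds each new derivative on the outside; moving one to the
  inside is what shifts the order of the seminorms when a test function is replaced by its
  derivative.\<close>

lemma nth_deriv_vector_derivative:
  "nth_deriv n (\<lambda>x. vector_derivative f (at x)) = nth_deriv (Suc n) f"
  unfolding nth_deriv_def by (subst funpow_Suc_right) simp

lemma smooth_on_imp_differentiable:
  assumes "smooth_on S f" "x \<in> S"
  shows "f differentiable (at x)" "(\<lambda>x. vector_derivative f (at x)) differentiable (at x)"
proof -
  have "nth_deriv 0 f differentiable (at x)" "nth_deriv (Suc 0) f differentiable (at x)"
    using assms unfolding smooth_on_def by blast+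
  moreover have "nth_deriv (Suc 0) f = (\<lambda>x. vector_derivative f (at x))"
    by (simp add: nth_deriv_def)
  ultimately show "f differentiable (at x)" "(\<lambda>x. vector_derivative f (at x)) differentiable (at x)"
    by simp_all
qed

section \<open>Continuity, support and derivatives of test functions\<close>

lemma test_function_has_vector_derivative:
  assumes "test_function \<psi>"
  shows "(\<psi> has_vector_derivative vector_derivative \<psi> (at x)) (at x)"
  using assms smooth_on_imp_differentiable(1)[of UNIV \<psi> x]
  by (simp add: test_function_def vector_derivative_works)

lemma test_function_continuous:
  assumes "test_function \<psi>"
  shows "continuous_on S \<psi>"
  using assms smooth_on_imp_differentiable(1)[of UNIV \<psi>] differentiable_imp_continuous_within
    continuous_at_imp_continuous_on
  by (metis test_function_def UNIV_I)

lemma test_function_borel_measurable [measurable_dest]: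
  assumes "test_function \<psi>"
  shows "\<psi> \<in> borel_measurable borel"
  by (rule borel_measurable_continuous_onI[OF test_function_continuous[OF assms]])

text \<open>The complement of the closed support is open and \<open>\<psi>\<close> is 0 there, so
  its derivative is 0 there. Differentiability is only at stake off the support, hence the lemma
  holds for arbitrary \<open>\<psi>\<close>.\<close>

lemma closure_support_vector_derivative:
  "closure {x. vector_derivative \<psi> (at x) \<noteq> 0} \<subseteq> closure {x. \<psi> x \<noteq> 0}"
proof (rule closure_minimal)
  show "{x. vector_derivative \<psi> (at x) \<noteq> 0} \<subseteq> closure {x. \<psi> x \<noteq> 0}"
  proof
    fix x assume x: "x \<in> {x. vector_derivative \<psi> (at x) \<noteq> 0}"
    show "x \<in> closure {x. \<psi> x \<noteq> 0}"
    proof (rule ccontr)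
      assume "x \<notin> closure {x. \<psi> x \<noteq> 0}"
      then have x': "x \<in> - closure {x. \<psi> x \<noteq> 0}"
        by simp
      have "(\<psi> has_vector_derivative 0) (at x)"
      proof (rule has_vector_derivative_transform_within_open[OF has_vector_derivative_const _ x'])
        fix y assume "y \<in> - closure {x. \<psi> x \<noteq> 0}"
        then have "y \<notin> {x. \<psi> x \<noteq> 0}"
          using closure_subset[of "{x. \<psi> x \<noteq> 0}"] by blast
        then show "0 = \<psi> y"
          by simp
      qed (rule open_Compl[OF closed_closure])
      with x show False
        by (simp add: vector_derivative_at)
    qed
  qed
qed simp

lemma test_function_vector_derivative:
  assumes "test_function \<psi>"
  shows "test_function (\<lambda>x. vector_derivative \<psi> (at x))"
proof -
  have "smooth_on UNIV (\<lambda>x. vector_derivative \<psi> (at x))"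
    using assms by (simp add: test_function_def smooth_on_def nth_deriv_vector_derivative)
  moreover have "compact (closure {x. vector_derivative \<psi> (at x) \<noteq> 0})"
    using compact_Int_closed[of "closure {x. \<psi> x \<noteq> 0}"
        "closure {x. vector_derivative \<psi> (at x) \<noteq> 0}"] assms closure_support_vector_derivative[of \<psi>]
    by (simp add: test_function_def Int_absorb1)
  ultimately show ?thesis
    by (simp add: test_function_def)
qed

lemma test_function_nth_deriv:
  assumes "test_function \<psi>"
  shows "test_function (nth_deriv n \<psi>)"
  using assms
proof (induction n)
  case (Suc n)
  then show ?case
    using test_function_vector_derivative[of "nth_deriv n \<psi>"] by (simp add: nth_deriv_def)
qed simp

text \<open>A real \<open>SUP\<close> carries information only over a set that is bounded above;
  continuity on the compact support provides the bound for the seminorms below.\<close>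

lemma test_function_bdd_above:
  assumes "test_function \<psi>"
  shows "bdd_above (range (\<lambda>x. cmod (\<psi> x)))"
proof -
  let ?K = "closure {x. \<psi> x \<noteq> 0}"
  have "compact ((\<lambda>x. cmod (\<psi> x)) ` ?K)"
    using assms
    by (intro compact_continuous_image continuous_on_norm test_function_continuous)
       (auto simp: test_function_def)
  then have "bdd_above ((\<lambda>x. cmod (\<psi> x)) ` ?K)"
    by (rule bounded_imp_bdd_above[OF compact_imp_bounded])
  then obtain M where M: "\<And>x. x \<in> ?K \<Longrightarrow> cmod (\<psi> x) \<le> M"
    by (auto simp: bdd_above_def)
  \<comment> \<open>Taking the maximum with 0 covers the points off the support, about which
    \<open>M\<close> says nothing; for empty support \<open>M\<close> could even be
    negative.\<close>
  have "cmod (\<psi> x) \<le> max M 0" for x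
    using M[of x] closure_subset[of "{x. \<psi> x \<noteq> 0}"] by (cases "\<psi> x = 0") auto
  then show ?thesis
    unfolding bdd_above_def by blast
qed

section \<open>Seminorms of test functions\<close>

lemma norm_test_function_le_SUP:
  assumes "test_function \<psi>"
  shows "cmod (\<psi> x) \<le> (SUP x. cmod (\<psi> x))"
  by (rule cSUP_upper[OF UNIV_I test_function_bdd_above[OF assms]])

text \<open>The C^m norm that occurs in the continuity clause of \<open>distribution\<close>, named
  so that estimates of different orders can be compared.\<close>

definition test_norm :: "nat \<Rightarrow> (real \<Rightarrow> complex) \<Rightarrow> real" where
  "test_norm m \<psi> = (\<Sum>k\<le>m. SUP x. cmod (nth_deriv k \<psi> x))"

lemma SUP_nth_deriv_nonneg:
  assumes "test_function \<psi>"
  shows "0 \<le> (SUP x. cmod (nth_deriv k \<psi> x))"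
  by (rule order_trans[OF norm_ge_zero
        norm_test_function_le_SUP[OF test_function_nth_deriv[OF assms], where x = 0]])

lemma test_norm_nonneg: "test_function \<psi> \<Longrightarrow> 0 \<le> test_norm m \<psi>"
  unfolding test_norm_def by (intro sum_nonneg SUP_nth_deriv_nonneg)

lemma test_norm_mono: "test_function \<psi> \<Longrightarrow> m \<le> n \<Longrightarrow> test_norm m \<psi> \<le> test_norm n \<psi>"
  unfolding test_norm_def by (intro sum_mono2 SUP_nth_deriv_nonneg) auto

text \<open>After a shift of the index, the left side is the right side without its summand of order
  0, which is nonnegative.\<close>

lemma test_norm_vector_derivative:
  assumes "test_function \<psi>"
  shows "test_norm m (\<lambda>x. vector_derivative \<psi> (at x)) \<le> test_norm (Suc m) \<psi>"
  using SUP_nth_deriv_nonneg[OF assms, of 0]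
  unfolding test_norm_def nth_deriv_vector_derivative
  by (subst sum.atMost_Suc_shift) simp

section \<open>Closure properties of distributions\<close>

lemma distribution_iff:
  "distribution T \<longleftrightarrow>
     (\<forall>\<psi> \<eta>. test_function \<psi> \<longrightarrow> test_function \<eta> \<longrightarrow> T (\<lambda>x. \<psi> x + \<eta> x) = T \<psi> + T \<eta>) \<and>
     (\<forall>a \<psi>. test_function \<psi> \<longrightarrow> T (\<lambda>x. a * \<psi> x) = a * T \<psi>) \<and>
     (\<forall>K. compact K \<longrightarrow> (\<exists>C m. \<forall>\<psi>. test_function \<psi> \<longrightarrow> closure {x. \<psi> x \<noteq> 0} \<subseteq> K \<longrightarrow>
        cmod (T \<psi>) \<le> C * test_norm m \<psi>))"
  unfolding distribution_def test_norm_def ..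

text \<open>The constant in \<open>distribution\<close> has no prescribed sign. Since the seminorms
  are nonnegative it may be replaced by its absolute value, and inequalities between seminorms can
  then be multiplied by it.\<close>

lemma distribution_bound:
  assumes "distribution T" "compact K"
  obtains C m where "C \<ge> 0"
    "\<And>\<psi>. test_function \<psi> \<Longrightarrow> closure {x. \<psi> x \<noteq> 0} \<subseteq> K \<Longrightarrow> cmod (T \<psi>) \<le> C * test_norm m \<psi>"
proof -
  obtain C m where *: "\<And>\<psi>. test_function \<psi> \<Longrightarrow> closure {x. \<psi> x \<noteq> 0} \<subseteq> K \<Longrightarrow>
      cmod (T \<psi>) \<le> C * test_norm m \<psi>"
    using assms unfolding distribution_iff by blast
  have "cmod (T \<psi>) \<le> \<bar>C\<bar> * test_norm m \<psi>"
    if "test_function \<psi>" "closure {x. \<psi> x \<noteq> 0} \<subseteq> K" for \<psi>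
    using *[OF that] mult_right_mono[OF abs_ge_self test_norm_nonneg[OF that(1)], of C m] by simp
  then show ?thesis
    by (rule that[of "\<bar>C\<bar>" m, OF abs_ge_zero])
qed

lemma distribution_add:
  assumes "distribution S" "distribution T"
  shows "distribution (\<lambda>\<psi>. S \<psi> + T \<psi>)"
proof -
  have "\<exists>C m. \<forall>\<psi>. test_function \<psi> \<longrightarrow> closure {x. \<psi> x \<noteq> 0} \<subseteq> K \<longrightarrow>
      cmod (S \<psi> + T \<psi>) \<le> C * test_norm m \<psi>" if K: "compact K" for K
  proof -
    obtain C m where S: "C \<ge> 0" "\<And>\<psi>. test_function \<psi> \<Longrightarrow> closure {x. \<psi> x \<noteq> 0} \<subseteq> K \<Longrightarrow>
        cmod (S \<psi>) \<le> C * test_norm m \<psi>"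
      using distribution_bound[OF assms(1) K] by metis
    obtain D n where T: "D \<ge> 0" "\<And>\<psi>. test_function \<psi> \<Longrightarrow> closure {x. \<psi> x \<noteq> 0} \<subseteq> K \<Longrightarrow>
        cmod (T \<psi>) \<le> D * test_norm n \<psi>"
      using distribution_bound[OF assms(2) K] by metis
    \<comment> \<open>The two estimates may have different orders; both hold at the larger one
      because the seminorms increase with the order.\<close>
    have "cmod (S \<psi> + T \<psi>) \<le> (C + D) * test_norm (max m n) \<psi>"
      if \<psi>: "test_function \<psi>" "closure {x. \<psi> x \<noteq> 0} \<subseteq> K" for \<psi>
    proof -
      have "cmod (S \<psi> + T \<psi>) \<le> cmod (S \<psi>) + cmod (T \<psi>)"
        by (rule norm_triangle_ineq)
      also have "\<dots> \<le> C * test_norm m \<psi> + D * test_norm n \<psi>"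
        using S(2)[OF \<psi>] T(2)[OF \<psi>] by simp
      also have "\<dots> \<le> C * test_norm (max m n) \<psi> + D * test_norm (max m n) \<psi>"
        using S(1) T(1) by (intro add_mono mult_left_mono test_norm_mono \<psi>) auto
      finally show ?thesis
        by (simp add: distrib_right)
    qed
    then show ?thesis by blast
  qed
  then show ?thesis
    using assms by (simp add: distribution_iff algebra_simps)
qed

lemma distribution_cmult:
  assumes "distribution T"
  shows "distribution (\<lambda>\<psi>. z * T \<psi>)"
proof -
  have "\<exists>C m. \<forall>\<psi>. test_function \<psi> \<longrightarrow> closure {x. \<psi> x \<noteq> 0} \<subseteq> K \<longrightarrow>
      cmod (z * T \<psi>) \<le> C * test_norm m \<psi>" if K: "compact K" for K
  proof -
    obtain C m where T: "\<And>\<psi>. test_function \<psi> \<Longrightarrow> closure {x. \<psi> x \<noteq> 0} \<subseteq> K \<Longrightarrow>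
        cmod (T \<psi>) \<le> C * test_norm m \<psi>"
      using distribution_bound[OF assms K] by metis
    then have "cmod (z * T \<psi>) \<le> (cmod z * C) * test_norm m \<psi>"
      if "test_function \<psi>" "closure {x. \<psi> x \<noteq> 0} \<subseteq> K" for \<psi>
      using that by (simp add: norm_mult mult.assoc mult_left_mono)
    then show ?thesis by blast
  qed
  then show ?thesis
    using assms by (simp add: distribution_iff algebra_simps)
qed

text \<open>Differentiation maps test functions supported in \<open>K\<close> to test functions
  supported in \<open>K\<close>, so the estimate for \<open>T\<close> carries over with the order
  raised by one.\<close>

lemma distribution_dist_deriv:
  assumes "distribution T"
  shows "distribution (dist_deriv T)"
proof -
  have "dist_deriv T (\<lambda>x. \<psi> x + \<eta> x) = dist_deriv T \<psi> + dist_deriv T \<eta>"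
    if "test_function \<psi>" "test_function \<eta>" for \<psi> \<eta>
  proof -
    have "(\<lambda>x. vector_derivative (\<lambda>x. \<psi> x + \<eta> x) (at x)) =
        (\<lambda>x. vector_derivative \<psi> (at x) + vector_derivative \<eta> (at x))"
      using that
      by (intro ext vector_derivative_at has_vector_derivative_add
          test_function_has_vector_derivative)
    then show ?thesis
      using assms that by (simp add: dist_deriv_def distribution_iff test_function_vector_derivative)
  qed
  moreover have "dist_deriv T (\<lambda>x. a * \<psi> x) = a * dist_deriv T \<psi>" if "test_function \<psi>" for a \<psi>
  proof -
    have "(\<lambda>x. vector_derivative (\<lambda>x. a * \<psi> x) (at x)) = (\<lambda>x. a * vector_derivative \<psi> (at x))"
      using that
      by (intro ext vector_derivative_at has_vector_derivative_mult_right
          test_function_has_vector_derivative)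
    then show ?thesis
      using assms that by (simp add: dist_deriv_def distribution_iff test_function_vector_derivative)
  qed
  moreover have "\<exists>C m. \<forall>\<psi>. test_function \<psi> \<longrightarrow> closure {x. \<psi> x \<noteq> 0} \<subseteq> K \<longrightarrow>
      cmod (dist_deriv T \<psi>) \<le> C * test_norm m \<psi>" if K: "compact K" for K
  proof -
    obtain C m where T: "C \<ge> 0" "\<And>\<psi>. test_function \<psi> \<Longrightarrow> closure {x. \<psi> x \<noteq> 0} \<subseteq> K \<Longrightarrow>
        cmod (T \<psi>) \<le> C * test_norm m \<psi>"
      using distribution_bound[OF assms K] by metis
    have "cmod (dist_deriv T \<psi>) \<le> C * test_norm (Suc m) \<psi>"
      if \<psi>: "test_function \<psi>" "closure {x. \<psi> x \<noteq> 0} \<subseteq> K" for \<psi>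
    proof -
      have "cmod (dist_deriv T \<psi>) \<le> C * test_norm m (\<lambda>x. vector_derivative \<psi> (at x))"
        using T(2)[OF test_function_vector_derivative[OF \<psi>(1)]]
          order_trans[OF closure_support_vector_derivative \<psi>(2)]
        by (simp add: dist_deriv_def)
      also have "\<dots> \<le> C * test_norm (Suc m) \<psi>"
        by (intro mult_left_mono test_norm_vector_derivative \<psi> T(1))
      finally show ?thesis .
    qed
    then show ?thesis by blast
  qed
  ultimately show ?thesis
    unfolding distribution_iff by blast
qed

section \<open>Integrable functions as distributions\<close>

lemma integrable_mult_test_function:
  assumes "integrable lborel f" "test_function \<psi>"
  shows "integrable lborel (\<lambda>x. f x * \<psi> x)"
proof (rule Bochner_Integration.integrable_bound)
  show "integrable lborel (\<lambda>x. (SUP x. cmod (\<psi> x)) * cmod (f x))"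
    using assms(1) by simp
  show "(\<lambda>x. f x * \<psi> x) \<in> borel_measurable lborel"
    using assms(1) test_function_borel_measurable[OF assms(2)] by measurable
  have "cmod (f x * \<psi> x) \<le> norm ((SUP x. cmod (\<psi> x)) * cmod (f x))" for x
    using mult_right_mono[OF order_trans[OF norm_test_function_le_SUP[OF assms(2), of x] abs_ge_self]
        norm_ge_zero[of "f x"]]
    by (simp add: norm_mult abs_mult mult.commute)
  then show "AE x in lborel. cmod (f x * \<psi> x) \<le> norm ((SUP x. cmod (\<psi> x)) * cmod (f x))"
    by simp
qed

text \<open>The pairing has order 0, and the L^1 norm of \<open>f\<close> serves as the constant for
  every compact set at once.\<close>

lemma distribution_dist_of_fun:
  assumes "integrable lborel f"
  shows "distribution (dist_of_fun f)"
proof -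
  have "cmod (dist_of_fun f \<psi>) \<le> (LINT x|lborel. cmod (f x)) * test_norm 0 \<psi>"
    if \<psi>: "test_function \<psi>" for \<psi>
  proof -
    have "cmod (dist_of_fun f \<psi>) \<le> (LINT x|lborel. cmod (f x * \<psi> x))"
      unfolding dist_of_fun_def by (rule integral_norm_bound)
    also have "\<dots> \<le> (LINT x|lborel. cmod (f x) * test_norm 0 \<psi>)"
    proof (rule integral_mono)
      show "cmod (f x * \<psi> x) \<le> cmod (f x) * test_norm 0 \<psi>" for x
        using norm_test_function_le_SUP[OF \<psi>, of x]
        by (simp add: norm_mult test_norm_def mult_left_mono)
    qed (use assms integrable_mult_test_function[OF assms \<psi>] in simp_all)
    finally show ?thesis by simp
  qed
  then have "\<exists>C m. \<forall>\<psi>. test_function \<psi> \<longrightarrow> closure {x. \<psi> x \<noteq> 0} \<subseteq> K \<longrightarrow>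
      cmod (dist_of_fun f \<psi>) \<le> C * test_norm m \<psi>" for K
    by blast
  moreover have "dist_of_fun f (\<lambda>x. \<psi> x + \<eta> x) = dist_of_fun f \<psi> + dist_of_fun f \<eta>"
    if "test_function \<psi>" "test_function \<eta>" for \<psi> \<eta>
    using integrable_mult_test_function[OF assms that(1)]
      integrable_mult_test_function[OF assms that(2)]
    by (simp add: dist_of_fun_def distrib_left)
  moreover have "dist_of_fun f (\<lambda>x. a * \<psi> x) = a * dist_of_fun f \<psi>" for a \<psi>
    by (simp add: dist_of_fun_def mult.left_commute)
  ultimately show ?thesis
    unfolding distribution_iff by blast
qed

section \<open>Integrability on a bounded support and exhaustion by smaller intervals\<close>

lemma integrable_continuous_vanishing_outside:
  fixes f :: "real \<Rightarrow> complex"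
  assumes "continuous_on UNIV f" "\<And>x. x \<notin> {a..b} \<Longrightarrow> f x = 0"
  shows "integrable lborel f"
proof -
  have "integrable lborel (\<lambda>x. indicator {a..b} x *\<^sub>R f x)"
    by (rule borel_integrable_compact) (use assms(1) continuous_on_subset in blast)+
  also have "(\<lambda>x. indicator {a..b} x *\<^sub>R f x) = f"
    using assms(2) by (auto simp: indicator_def)
  finally show ?thesis .
qed

text \<open>Dominated convergence with majorant \<open>cmod (f x)\<close>: each point of the open
  interval eventually lies in the truncated one, and elsewhere the integrands are 0.\<close>

lemma set_integral_exhaust_interval:
  fixes f :: "real \<Rightarrow> complex"
  assumes "integrable lborel f" "\<And>x. x \<notin> {-X<..<X} \<Longrightarrow> f x = 0"
  shows "((\<lambda>\<epsilon>. LINT x:{x. \<bar>x\<bar> < X - \<epsilon>}|lborel. f x) \<longlongrightarrow> (LINT x|lborel. f x)) (at_right 0)"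
proof -
  have m: "{x. \<bar>x\<bar> < X - \<epsilon>} \<in> sets borel" for \<epsilon> :: real
    by measurable
  have "((\<lambda>\<epsilon>. LINT x|lborel. indicator {x. \<bar>x\<bar> < X - \<epsilon>} x *\<^sub>R f x) \<longlongrightarrow> (LINT x|lborel. f x))
      (at_right 0)"
  \<comment> \<open>Dominated convergence is applied along sequences decreasing to 0; the 1 is an
    arbitrary upper bound for their terms.\<close>
  proof (rule tendsto_at_right_sequentially[of 0 1])
    fix s :: "nat \<Rightarrow> real"
    assume s: "\<And>n. 0 < s n" "s \<longlonglongrightarrow> 0"
    show "(\<lambda>n. LINT x|lborel. indicator {x. \<bar>x\<bar> < X - s n} x *\<^sub>R f x) \<longlonglongrightarrow> (LINT x|lborel. f x)"
    proof (rule integral_dominated_convergence[where w = "\<lambda>x. cmod (f x)"])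
      have "(\<lambda>n. indicator {x. \<bar>x\<bar> < X - s n} x *\<^sub>R f x) \<longlonglongrightarrow> f x" for x
      proof (cases "x \<in> {-X<..<X}")
        case True
        then have "eventually (\<lambda>n. s n < X - \<bar>x\<bar>) sequentially"
          using s(2) by (intro order_tendstoD(2)) auto
        then have "eventually (\<lambda>n. indicator {x. \<bar>x\<bar> < X - s n} x *\<^sub>R f x = f x) sequentially"
          by eventually_elim simp
        then show ?thesis
          by (rule tendsto_eventually)
      qed (simp add: assms(2))
      then show "AE x in lborel. (\<lambda>n. indicator {x. \<bar>x\<bar> < X - s n} x *\<^sub>R f x) \<longlonglongrightarrow> f x"
        by simp
    next
      fix n
      show "(\<lambda>x. indicator {x. \<bar>x\<bar> < X - s n} x *\<^sub>R f x) \<in> borel_measurable lborel"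
        using assms(1) m[of "s n"] by (intro borel_measurable_scaleR borel_measurable_indicator) auto
      show "AE x in lborel. cmod (indicator {x. \<bar>x\<bar> < X - s n} x *\<^sub>R f x) \<le> cmod (f x)"
        by (simp add: indicator_def)
    qed (use assms(1) in simp_all)
  qed simp
  then show ?thesis
    by (simp add: set_lebesgue_integral_def)
qed

subsection \<open>The wave profile inside its support\<close>

context
  fixes v X :: real and \<Phi> \<theta> :: "real \<Rightarrow> real"
  assumes pos: "\<And>x. x \<in> {-X<..<X} \<Longrightarrow> \<Phi> x > 0"
    and smooth: "smooth_on {-X<..<X} \<Phi>"
    and phase: "phase X \<Phi> \<theta>"
begin

private definition E :: "real \<Rightarrow> complex" where
  "E x = exp (\<i> * complex_of_real (v * \<theta> x))"

private lemma profile_eq: "x \<in> {-X<..<X} \<Longrightarrow> wave_profile v X \<Phi> \<theta> x = \<Phi> x * E x"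
  by (simp add: wave_profile_def E_def)

private lemma norm_E: "cmod (E x) = 1"
  unfolding E_def by (rule norm_exp_i_times)

private lemma E_has_vector_derivative:
  assumes "x \<in> {-X<..<X}"
  shows "(E has_vector_derivative (- \<i> * v / (2 * (\<Phi> x)\<^sup>2)) * E x) (at x)"
proof -
  have "((\<lambda>x. v * \<theta> x) has_real_derivative v * (- 1 / (2 * (\<Phi> x)\<^sup>2))) (at x)"
    using assms phase by (intro DERIV_cmult) (simp add: phase_def)
  then have "((\<lambda>x. complex_of_real (v * \<theta> x)) has_vector_derivative
      complex_of_real (v * (- 1 / (2 * (\<Phi> x)\<^sup>2)))) (at x)"
    by (rule has_vector_derivative_of_real)
  then have "((\<lambda>x. \<i> * complex_of_real (v * \<theta> x)) has_vector_derivative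
      \<i> * complex_of_real (v * (- 1 / (2 * (\<Phi> x)\<^sup>2)))) (at x)"
    by (rule has_vector_derivative_mult_right)
  from field_vector_diff_chain_at[OF this DERIV_exp] show ?thesis
    by (simp add: o_def E_def[abs_def])
qed

text \<open>Smoothness is phrased with \<open>vector_derivative\<close>, the equation for
  \<open>\<Phi>\<close> with \<open>deriv\<close>. The two agree throughout the open interval, so
  differentiability passes from one to the other.\<close>

private lemma amplitude_derivs:
  assumes "x \<in> {-X<..<X}"
  shows "(\<Phi> has_real_derivative deriv \<Phi> x) (at x)"
    and "((\<lambda>y. \<Phi> y * deriv \<Phi> y) has_real_derivative deriv (\<lambda>y. \<Phi> y * deriv \<Phi> y) x) (at x)"
    and "isCont (deriv \<Phi>) x"
proof -
  have d: "(\<Phi> has_real_derivative vector_derivative \<Phi> (at y)) (at y)" if "y \<in> {-X<..<X}" for y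
    using smooth_on_imp_differentiable(1)[OF smooth that]
    by (simp add: vector_derivative_works has_real_derivative_iff_has_vector_derivative)
  then have deriv_eq: "deriv \<Phi> y = vector_derivative \<Phi> (at y)" if "y \<in> {-X<..<X}" for y
    using that DERIV_imp_deriv by blast
  show 1: "(\<Phi> has_real_derivative deriv \<Phi> x) (at x)"
    using d[OF assms] deriv_eq[OF assms] by simp
  have "((\<lambda>x. vector_derivative \<Phi> (at x)) has_real_derivative
      vector_derivative (\<lambda>x. vector_derivative \<Phi> (at x)) (at x)) (at x)"
    using smooth_on_imp_differentiable(2)[OF smooth assms]
    by (simp add: vector_derivative_works has_real_derivative_iff_has_vector_derivative)
  then have 2: "(deriv \<Phi> has_real_derivative
      vector_derivative (\<lambda>x. vector_derivative \<Phi> (at x)) (at x)) (at x)"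
    by (rule has_field_derivative_transform_within_open[where S = "{-X<..<X}"])
       (use assms deriv_eq in auto)
  then show "isCont (deriv \<Phi>) x"
    by (rule DERIV_isCont)
  show "((\<lambda>y. \<Phi> y * deriv \<Phi> y) has_real_derivative deriv (\<lambda>y. \<Phi> y * deriv \<Phi> y) x) (at x)"
    using DERIV_mult[OF 1 2] DERIV_deriv_iff_has_field_derivative by blast
qed

text \<open>Closed form of the derivative of the profile inside the support. The second term comes
  from the phase and, for nonzero \<open>v\<close>, blows up where \<open>\<Phi>\<close> tends to
  0.\<close>

private definition Q' :: "real \<Rightarrow> complex" where
  "Q' x = (deriv \<Phi> x - \<i> * v / (2 * \<Phi> x)) * E x"

private lemma profile_has_vector_derivative:
  assumes "x \<in> {-X<..<X}"
  shows "(wave_profile v X \<Phi> \<theta> has_vector_derivative Q' x) (at x)"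
proof -
  have "((\<lambda>x. complex_of_real (\<Phi> x) * E x) has_vector_derivative
      \<Phi> x * ((- \<i> * v / (2 * (\<Phi> x)\<^sup>2)) * E x) + complex_of_real (deriv \<Phi> x) * E x) (at x)"
    by (intro has_vector_derivative_mult has_vector_derivative_of_real amplitude_derivs
        E_has_vector_derivative assms)
  also have "\<Phi> x * ((- \<i> * v / (2 * (\<Phi> x)\<^sup>2)) * E x) + complex_of_real (deriv \<Phi> x) * E x = Q' x"
    using pos[OF assms] by (simp add: Q'_def field_simps power2_eq_square)
  finally show ?thesis
    by (rule has_vector_derivative_transform_within_open[where S = "{-X<..<X}"])
       (use assms profile_eq in auto)
qed

private lemma continuous_on_Q': "continuous_on {-X<..<X} Q'"
proof -
  have "continuous_on {-X<..<X} E" "continuous_on {-X<..<X} \<Phi>" "continuous_on {-X<..<X} (deriv \<Phi>)"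
    using E_has_vector_derivative amplitude_derivs(1,3) has_vector_derivative_continuous DERIV_isCont
    by (blast intro: continuous_at_imp_continuous_on)+
  moreover have "\<Phi> x \<noteq> 0" if "x \<in> {-X<..<X}" for x
    using pos[OF that] by simp
  ultimately show ?thesis
    unfolding Q'_def by (intro continuous_intros) auto
qed

text \<open>In \<open>Q Q' = (\<Phi> \<Phi>' - i v / 2) E^2\<close> the singular factor
  \<open>1 / \<Phi>\<close> has cancelled. Differentiating \<open>E^2\<close> brings it back as the
  factor \<open>- i v / \<Phi>^2\<close>, and after multiplication by \<open>cnj Q\<close> this
  contribution is \<open>- i v (\<Phi>' - i v / (2 \<Phi>)) E\<close>, that is
  \<open>- i v Q'\<close>. The two copies of \<open>E\<close> double the phase derivative, which
  explains the factor \<open>1 / 2\<close> in \<open>phase\<close>.\<close>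

private lemma profile_pointwise:
  assumes x: "x \<in> {-X<..<X}"
  shows "cnj (wave_profile v X \<Phi> \<theta> x) *
      vector_derivative
        (\<lambda>y. wave_profile v X \<Phi> \<theta> y * vector_derivative (wave_profile v X \<Phi> \<theta>) (at y)) (at x)
    = (\<Phi> x * deriv (\<lambda>y. \<Phi> y * deriv \<Phi> y) x) * E x - \<i> * v * Q' x"
proof -
  let ?D = "deriv (\<lambda>y. \<Phi> y * deriv \<Phi> y) x"
  let ?k = "- \<i> * v / (2 * (\<Phi> x)\<^sup>2)"
  have "((\<lambda>y. complex_of_real (\<Phi> y * deriv \<Phi> y) - \<i> * v / 2) has_vector_derivative
      complex_of_real ?D - 0) (at x)"
    by (intro has_vector_derivative_diff has_vector_derivative_of_real amplitude_derivs
        has_vector_derivative_const x)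
  moreover have "((\<lambda>y. E y * E y) has_vector_derivative E x * (?k * E x) + (?k * E x) * E x) (at x)"
    by (intro has_vector_derivative_mult E_has_vector_derivative x)
  ultimately have "((\<lambda>y. (complex_of_real (\<Phi> y * deriv \<Phi> y) - \<i> * v / 2) * (E y * E y))
      has_vector_derivative
        (complex_of_real (\<Phi> x * deriv \<Phi> x) - \<i> * v / 2) * (E x * (?k * E x) + (?k * E x) * E x)
        + (complex_of_real ?D - 0) * (E x * E x)) (at x)" (is "(?f has_vector_derivative ?f') _")
    by (rule has_vector_derivative_mult)
  then have "((\<lambda>y. wave_profile v X \<Phi> \<theta> y * vector_derivative (wave_profile v X \<Phi> \<theta>) (at y))
      has_vector_derivative ?f') (at x)"
  proof (rule has_vector_derivative_transform_within_open[where S = "{-X<..<X}"])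
    fix y assume y: "y \<in> {-X<..<X}"
    show "?f y = wave_profile v X \<Phi> \<theta> y * vector_derivative (wave_profile v X \<Phi> \<theta>) (at y)"
      using pos[OF y]
      by (simp add: profile_eq[OF y] vector_derivative_at[OF profile_has_vector_derivative[OF y]]
          Q'_def field_simps)
  qed (use x in auto)
  then have "vector_derivative
      (\<lambda>y. wave_profile v X \<Phi> \<theta> y * vector_derivative (wave_profile v X \<Phi> \<theta>) (at y)) (at x) = ?f'"
    by (rule vector_derivative_at)
  moreover have "cnj (\<Phi> x * E x) * ?f' = (\<Phi> x * ?D) * E x - \<i> * v * Q' x"
  proof -
    \<comment> \<open>A rational identity in which \<open>e'\<close> stands for the conjugate of
      \<open>e\<close> but is treated as independent; the factor \<open>e' * e\<close> is set to 1
      only afterwards.\<close>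
    have *: "(a * e') * ((a * b - u / 2) * (e * (- u / (2 * a\<^sup>2) * e)
          + (- u / (2 * a\<^sup>2) * e) * e) + (d - 0) * (e * e))
        = (a * d * e - u * ((b - u / (2 * a)) * e)) * (e' * e)"
      if "a \<noteq> 0" for a b d u e e' :: complex
      using that by (simp add: field_simps power2_eq_square)
    have "cnj (E x) * E x = 1"
      using complex_norm_square[of "E x"] norm_E[of x] by (simp add: mult.commute)
    then show ?thesis
      using *[of "complex_of_real (\<Phi> x)" "cnj (E x)" "deriv \<Phi> x" "\<i> * v" "E x" ?D] pos[OF x]
      by (simp add: Q'_def)
  qed
  ultimately show ?thesis
    by (simp add: profile_eq[OF x])
qed

section \<open>Continuity across the endpoints and integration by parts\<close>

text \<open>The phase need not have a limit at the endpoints, but the modulus of the profile is at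
  most \<open>\<Phi>\<close>, which tends to 0 there; this squeeze covers the endpoints and the
  exterior together.\<close>

private lemma continuous_on_profile:
  assumes "continuous_on UNIV \<Phi>" "\<And>x. x \<notin> {-X<..<X} \<Longrightarrow> \<Phi> x = 0"
  shows "continuous_on UNIV (wave_profile v X \<Phi> \<theta>)"
proof (rule continuous_at_imp_continuous_on, intro ballI)
  have outside: "wave_profile v X \<Phi> \<theta> y = 0" if "y \<notin> {-X<..<X}" for y
    unfolding wave_profile_def using that by (rule if_not_P)
  fix x :: real
  show "isCont (wave_profile v X \<Phi> \<theta>) x"
  proof (cases "x \<in> {-X<..<X}")
    case True
    then show ?thesis
      using profile_has_vector_derivative has_vector_derivative_continuous by blast
  next
    case False
    have "(\<Phi> \<longlongrightarrow> 0) (at x)"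
      using assms(1) assms(2)[OF False]
      by (metis UNIV_I continuous_on_eq_continuous_at isCont_def open_UNIV)
    moreover have "cmod (wave_profile v X \<Phi> \<theta> y) \<le> \<Phi> y" for y
    proof (cases "y \<in> {-X<..<X}")
      case True
      then show ?thesis
        using pos[OF True] by (simp add: profile_eq norm_mult norm_E)
    next
      case False
      show ?thesis
        unfolding outside[OF False] assms(2)[OF False] by simp
    qed
    ultimately have "(wave_profile v X \<Phi> \<theta> \<longlongrightarrow> 0) (at x)"
      using Lim_null_comparison[OF always_eventually] by metis
    then show ?thesis
      unfolding isCont_def outside[OF False] .
  qed
qed

text \<open>Integration by parts in the form of the fundamental theorem for \<open>F\<close>, whose
  derivative is \<open>f\<close>. With \<open>r < X\<close> the closed interval stays inside the
  support, away from the possible singularities of \<open>Q'\<close>.\<close>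

private lemma set_integral_deriv_profile:
  assumes "test_function \<psi>" "0 \<le> r" "r < X"
  defines "F \<equiv> \<lambda>x. wave_profile v X \<Phi> \<theta> x * \<psi> x"
    and "f \<equiv> \<lambda>x. wave_profile v X \<Phi> \<theta> x * vector_derivative \<psi> (at x) + Q' x * \<psi> x"
  shows "set_integrable lborel {x. \<bar>x\<bar> < r} f"
    and "(LINT x:{x. \<bar>x\<bar> < r}|lborel. f x) = F r - F (-r)"
proof -
  have D: "(F has_vector_derivative f x) (at x)" if "x \<in> {-X<..<X}" for x
    unfolding F_def f_def
    by (intro has_vector_derivative_mult profile_has_vector_derivative that
        test_function_has_vector_derivative assms(1))
  have "continuous_on {-X<..<X} (wave_profile v X \<Phi> \<theta>)"
    by (intro continuous_at_imp_continuous_on ballI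
        has_vector_derivative_continuous[OF profile_has_vector_derivative])
  then have "continuous_on {-X<..<X} f"
    unfolding f_def
    by (intro continuous_on_add continuous_on_mult continuous_on_Q'
        test_function_continuous[OF assms(1)]
        test_function_continuous[OF test_function_vector_derivative[OF assms(1)]])
  then have "continuous_on {-r..r} f"
    by (rule continuous_on_subset) (use assms(3) in auto)
  moreover have "(F has_vector_derivative f x) (at x within {-r..r})" if "-r \<le> x" "x \<le> r" for x
    by (rule has_vector_derivative_at_within[OF D]) (use assms(3) that in simp)
  ultimately have int: "has_bochner_integral lborel (\<lambda>x. indicator {-r..r} x *\<^sub>R f x) (F r - F (-r))"
    using assms(2) by (intro has_bochner_integral_FTC_Icc) simp_all
  have "has_bochner_integral lborel (\<lambda>x. indicator {x. \<bar>x\<bar> < r} x *\<^sub>R f x) (F r - F (-r))"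
  \<comment> \<open>The fundamental theorem uses the closed interval, the pairing the open one; they
    differ by the null set of the points \<open>r\<close> and \<open>-r\<close>.\<close>
  proof (rule has_bochner_integralI_AE[OF int])
    show "AE x in lborel. indicator {-r..r} x *\<^sub>R f x = indicator {x. \<bar>x\<bar> < r} x *\<^sub>R f x"
      using AE_lborel_singleton[of r] AE_lborel_singleton[of "-r"]
      by eventually_elim (auto simp: indicator_def)
    have "{x. \<bar>x\<bar> < r} \<in> sets borel"
      by measurable
    moreover have "continuous_on {x. \<bar>x\<bar> < r} f"
      by (rule continuous_on_subset[OF \<open>continuous_on {-r..r} f\<close>]) auto
    ultimately show "(\<lambda>x. indicator {x. \<bar>x\<bar> < r} x *\<^sub>R f x) \<in> borel_measurable lborel"
      by (simp add: borel_measurable_continuous_on_indicator)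
  qed
  then show "set_integrable lborel {x. \<bar>x\<bar> < r} f"
    and "(LINT x:{x. \<bar>x\<bar> < r}|lborel. f x) = F r - F (-r)"
    by (simp_all add: has_bochner_integral_iff set_integrable_def set_lebesgue_integral_def)
qed

section \<open>The equation in the sense of distributions\<close>

lemma wave_profile_solves:
  assumes p: "p > 2" and X: "X > 0"
    and cont: "continuous_on UNIV \<Phi>"
    and vanish: "\<And>x. x \<notin> {-X<..<X} \<Longrightarrow> \<Phi> x = 0"
    and ode: "\<And>x. x \<in> {-X<..<X} \<Longrightarrow>
      - c * \<Phi> x + \<Phi> x * deriv (\<lambda>y. \<Phi> y * deriv \<Phi> y) x + \<Phi> x powr (p - 1) = 0"
  shows "solves_profile_equation p v c X (wave_profile v X \<Phi> \<theta>)"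
proof -
  define Q where "Q = wave_profile v X \<Phi> \<theta>"
  define P where "P = (\<lambda>x. complex_of_real (cmod (Q x) powr (p - 2)) * Q x)"
  \<comment> \<open>\<open>N\<close> is the profile equation solved for its degenerate term, so the
    equation itself becomes algebra. What remains is that \<open>N\<close> is a distribution and
    equals the limit required by \<open>degenerate_term\<close>.\<close>
  define N where "N = (\<lambda>\<psi>. complex_of_real c * dist_of_fun Q \<psi>
      + (- 1) * dist_of_fun P \<psi> + (- \<i> * v) * dist_deriv (dist_of_fun Q) \<psi>)"
  have Q0: "Q x = 0" if "x \<notin> {-X<..<X}" for x
    using that by (auto simp: Q_def wave_profile_def)
  have Q0': "Q x = 0" if "x \<notin> {-X..X}" for x
    by (rule Q0) (use that in auto)
  have contQ: "continuous_on UNIV Q"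
    unfolding Q_def by (rule continuous_on_profile[OF cont vanish])
  \<comment> \<open>Because \<open>p > 2\<close>, the exponent \<open>p - 2\<close> is positive and
    the power is continuous also where \<open>Q\<close> vanishes.\<close>
  have "continuous_on UNIV P"
    unfolding P_def using contQ p
    by (intro continuous_intros continuous_on_powr') auto
  then have intP: "integrable lborel P"
    by (rule integrable_continuous_vanishing_outside[of _ "-X" X])
       (simp add: P_def Q0' del: atLeastAtMost_iff)
  have intQ: "integrable lborel Q"
    by (rule integrable_continuous_vanishing_outside[OF contQ Q0'])
  have "distribution N"
    unfolding N_def
    by (intro distribution_add distribution_cmult distribution_dist_deriv distribution_dist_of_fun
        intP intQ)
  moreover have "((\<lambda>\<epsilon>. LINT x:{x. \<bar>x\<bar> < X - \<epsilon>}|lborel.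
      cnj (Q x) * vector_derivative (\<lambda>y. Q y * vector_derivative Q (at y)) (at x) * \<psi> x)
      \<longlongrightarrow> N \<psi>) (at_right 0)" if \<psi>: "test_function \<psi>" for \<psi>
  proof -
    \<comment> \<open>The term \<open>i v Q \<psi>'\<close> is added and subtracted: inside the
      support the degenerate integrand is \<open>h - i v f\<close>. Here \<open>h\<close> is
      integrable on the whole line with integral \<open>N \<psi>\<close>, while \<open>f\<close> is
      the exact derivative of \<open>F\<close> and leaves only boundary values.\<close>
    define h where "h = (\<lambda>x. (c * Q x - P x) * \<psi> x + \<i> * v * (Q x * vector_derivative \<psi> (at x)))"
    define f where "f = (\<lambda>x. Q x * vector_derivative \<psi> (at x) + Q' x * \<psi> x)"
    define F where "F = (\<lambda>x. Q x * \<psi> x)"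
    note ints = integrable_mult_test_function[OF intQ \<psi>] integrable_mult_test_function[OF intP \<psi>]
      integrable_mult_test_function[OF intQ test_function_vector_derivative[OF \<psi>]]
    have inth: "integrable lborel h"
      unfolding h_def left_diff_distrib mult.assoc using ints by simp
    have "(LINT x|lborel. h x) = N \<psi>"
      unfolding h_def N_def dist_deriv_def dist_of_fun_def left_diff_distrib mult.assoc
      using ints by simp
    moreover have "((\<lambda>\<epsilon>. LINT x:{x. \<bar>x\<bar> < X - \<epsilon>}|lborel. h x) \<longlongrightarrow> (LINT x|lborel. h x)) (at_right 0)"
      by (rule set_integral_exhaust_interval[OF inth]) (simp add: h_def P_def Q0)
    \<comment> \<open>The limit is written with \<open>X - 0\<close>, the shape in which continuity
      of \<open>F\<close> delivers it; both values are 0 since \<open>Q\<close> vanishes at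
      \<open>X\<close> and \<open>-X\<close>.\<close>
    moreover have "((\<lambda>\<epsilon>. F (X - \<epsilon>) - F (- (X - \<epsilon>))) \<longlongrightarrow> F (X - 0) - F (- (X - 0))) (at_right 0)"
    proof -
      have "isCont F y" for y
        using continuous_on_mult[OF contQ test_function_continuous[OF \<psi>]]
        by (simp add: F_def continuous_on_eq_continuous_at)
      then show ?thesis
        by (intro tendsto_diff isCont_tendsto_compose[of _ F] tendsto_minus tendsto_const
            tendsto_ident_at)
    qed
    moreover have "F (X - 0) - F (- (X - 0)) = 0"
      by (simp add: F_def Q0)
    ultimately have lim: "((\<lambda>\<epsilon>. (LINT x:{x. \<bar>x\<bar> < X - \<epsilon>}|lborel. h x)
        - \<i> * v * (F (X - \<epsilon>) - F (- (X - \<epsilon>)))) \<longlongrightarrow> N \<psi> - \<i> * v * 0) (at_right 0)"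
      by (intro tendsto_diff tendsto_mult_left) simp_all
    have "(LINT x:{x. \<bar>x\<bar> < X - \<epsilon>}|lborel. h x) - \<i> * v * (F (X - \<epsilon>) - F (- (X - \<epsilon>)))
      = (LINT x:{x. \<bar>x\<bar> < X - \<epsilon>}|lborel.
          cnj (Q x) * vector_derivative (\<lambda>y. Q y * vector_derivative Q (at y)) (at x) * \<psi> x)"
      if \<epsilon>: "0 < \<epsilon>" "\<epsilon> < X" for \<epsilon>
    proof -
      let ?I = "{x. \<bar>x\<bar> < X - \<epsilon>}"
      have I: "?I \<in> sets borel"
        by measurable
      have fI: "set_integrable lborel ?I f" "(LINT x:?I|lborel. f x) = F (X - \<epsilon>) - F (- (X - \<epsilon>))"
        using set_integral_deriv_profile[OF \<psi>, of "X - \<epsilon>"] \<epsilon> by (simp_all add: f_def F_def Q_def)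
      have hI: "set_integrable lborel ?I h"
        using integrable_mult_indicator[OF _ inth] I by (simp add: set_integrable_def)
      have "cnj (Q x) * vector_derivative (\<lambda>y. Q y * vector_derivative Q (at y)) (at x) * \<psi> x
          = h x - \<i> * v * f x" if "x \<in> ?I" for x
      proof -
        have x: "x \<in> {-X<..<X}"
          using that \<epsilon> by auto
        have Qx: "Q x = \<Phi> x * E x" "cmod (Q x) = \<Phi> x"
          using pos[OF x] by (simp_all add: Q_def profile_eq[OF x] norm_mult norm_E)
        \<comment> \<open>Splitting off one factor \<open>\<Phi> x\<close> lets the real equation,
          multiplied by \<open>E x\<close>, become \<open>c * Q x - P x\<close>.\<close>
        have "\<Phi> x powr (p - 1) = \<Phi> x powr (p - 2) * \<Phi> x"
          using pos[OF x] powr_add[of "\<Phi> x" "p - 2" 1] by simp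
        then have "\<Phi> x * deriv (\<lambda>y. \<Phi> y * deriv \<Phi> y) x = c * \<Phi> x - \<Phi> x powr (p - 2) * \<Phi> x"
          using ode[OF x] by simp
        then have "(\<Phi> x * deriv (\<lambda>y. \<Phi> y * deriv \<Phi> y) x) * E x = c * Q x - P x"
          unfolding P_def Qx(2) unfolding Qx(1)
          by (metis (no_types, lifting) left_diff_distrib mult.assoc of_real_diff of_real_mult)
        with profile_pointwise[OF x]
        have eq: "cnj (Q x) * vector_derivative (\<lambda>y. Q y * vector_derivative Q (at y)) (at x)
            = c * Q x - P x - \<i> * v * Q' x"
          unfolding Q_def[symmetric] by simp
        show ?thesis
          unfolding eq by (simp add: h_def f_def algebra_simps)
      qed
      then have "(LINT x:?I|lborel.
          cnj (Q x) * vector_derivative (\<lambda>y. Q y * vector_derivative Q (at y)) (at x) * \<psi> x)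
        = (LINT x:?I|lborel. h x - \<i> * v * f x)"
        using I by (intro set_lebesgue_integral_cong) auto
      also have "\<dots> = (LINT x:?I|lborel. h x) - \<i> * v * (LINT x:?I|lborel. f x)"
        using hI fI(1) by simp
      finally show ?thesis
        by (simp add: fI(2))
    qed
    then have "eventually (\<lambda>\<epsilon>. (LINT x:{x. \<bar>x\<bar> < X - \<epsilon>}|lborel. h x)
        - \<i> * v * (F (X - \<epsilon>) - F (- (X - \<epsilon>)))
      = (LINT x:{x. \<bar>x\<bar> < X - \<epsilon>}|lborel.
          cnj (Q x) * vector_derivative (\<lambda>y. Q y * vector_derivative Q (at y)) (at x) * \<psi> x))
      (at_right 0)"
      using X by (intro eventually_at_rightI[of 0 X]) auto
    from Lim_transform_eventually[OF lim this] show ?thesis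
      by simp
  qed
  moreover have "- complex_of_real c * dist_of_fun Q \<psi>
      + \<i> * complex_of_real v * dist_deriv (dist_of_fun Q) \<psi> + N \<psi> + dist_of_fun P \<psi> = 0" for \<psi>
    by (simp add: N_def)
  ultimately show ?thesis
    unfolding solves_profile_equation_def degenerate_term_def P_def Q_def by blast
qed

end

theorem theorem1p4:
  fixes p v B c X :: real and \<Phi> \<theta> :: "real \<Rightarrow> real"
  assumes "p > 2"
    and "B > 0 \<or> (B = 0 \<and> c > 0)"
    and "compacton p B c X \<Phi>"
    and "phase X \<Phi> \<theta>"
  shows "solves_profile_equation p v c X (wave_profile v X \<Phi> \<theta>)"
  using assms(3) by (intro wave_profile_solves assms(1,4)) (auto simp: compacton_def)

end
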